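(* Let $k\ge 3$ be an integer, let $R_{k,n}^{i}(t)$ be the $k$ sequences of generalized Perrin polynomials and $V_{k,n}^{i}(t)$ the $k$ sequences of generalized Van der Laan polynomials. Then for every $1\le i\le k$ and every integer $n\ge 0$, $$R_{k,n}^{i}(t)=k\,V_{k,n}^{i}(t)-\sum_{j=1}^{k-2} j\,t_{k-j}\,V_{k,n-k+j}^{i}(t),$$ that is, $R_{k,n}^{i}(t)=(-t_{k-1})V_{k,n-k+1}^{i}(t)+\dots+(-t_{2}(k-2))V_{k,n-2}^{i}(t)+kV_{k,n}^{i}(t)$.
   Context: Let $k\ge 3$ and let $t_2,\dots,t_k$ be independent indeterminates over $\mathbb{Q}$ (with $t_1=0$); everything takes place in the field $\mathbb{Q}(t_2,\dots,t_k)$. Generalized Van der Laan polynomials: for $1\le i\le k$, the sequence $V_{k,n}^{i}(t)$, $n\ge 1-k$, is defined by $V_{k,n}^{i}(t)=1$ if $n=i-k$ and $V_{k,n}^{i}(t)=0$ otherwise, for $1-k\le n\le 0$, and $V_{k,n}^{i}(t)=\sum_{j=2}^{k}t_jV_{k,n-j}^{i}(t)$ for $n>0$. Let $V_{(k)}$ be the $k\times k$ matrix with $1$'s on the superdiagonal, last row $(t_k,t_{k-1},\dots,t_2,0)$, and all other entries $0$. It is invertible. Let $w=(w_1,\dots,w_k)$ be the row vector with $w_j=-j\,t_{k-j}$ for $1\le j\le k-2$, $w_{k-1}=0$, $w_k=k$, i.e. $w=(-t_{k-1},-2t_{k-2},\dots,-(k-2)t_2,0,k)$. Let $R_{(k)}$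 be the $k\times k$ matrix whose $r$-th row is $w\,(V_{(k)})^{-(k-r)}$ for $1\le r\le k$ (so the last row is $w$). Generalized Perrin polynomials: for $1\le i\le k$, the sequence $R_{k,n}^{i}(t)$, $n\ge 1-k$, is defined by letting $R_{k,n}^{i}(t)$ be the $(k+n,i)$ entry of $R_{(k)}$ for $1-k\le n\le 0$, and $R_{k,n}^{i}(t)=\sum_{j=2}^{k}t_jR_{k,n-j}^{i}(t)$ for $n>0$. *)

theory Defs
  imports
    "HOL-Library.Poly_Mapping"
    "HOL-Computational_Algebra.Fraction_Field"
    "Jordan_Normal_Form.Gauss_Jordan_Elimination"
    "Jordan_Normal_Form.Determinant"
begin

text \<open>
  Polynomials over the rationals in indeterminates indexed by \<open>nat\<close> (finitely supported
  exponent vectors mapped to coefficients), and their field of fractions. For every \<open>k\<close> the field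
  \<open>\<rat>(t\<^sub>2, \<dots>, t\<^sub>k)\<close> is the subfield generated by the indeterminates numbered \<open>2, \<dots>, k\<close>, and all
  the objects below that depend on \<open>k\<close> only involve these.
\<close>

type_synonym ratpoly = "(nat \<Rightarrow>\<^sub>0 nat) \<Rightarrow>\<^sub>0 rat"
type_synonym ratfun = "ratpoly fract"

definition indet :: "nat \<Rightarrow> ratpoly" where
  "indet j = Poly_Mapping.single (Poly_Mapping.single j 1) 1"

text \<open>The convention \<open>t\<^sub>1 = 0\<close> is built in; \<open>tvar 0\<close> is never used.\<close>

definition tvar :: "nat \<Rightarrow> ratfun" where
  "tvar j = (if j \<ge> 2 then Fraction_Field.Fract (indet j) 1 else 0)"

text \<open>The sequences start at \<open>n = 1 - k\<close>; their values for \<open>n < 1 - k\<close> carry no meaning.\<close>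

function van_der_laan :: "nat \<Rightarrow> nat \<Rightarrow> int \<Rightarrow> ratfun" where
  "van_der_laan k i n =
     (if n \<le> 0 then (if n = int i - int k then 1 else 0)
      else (\<Sum>j=2..k. tvar j * van_der_laan k i (n - int j)))"
  by pat_completeness auto
termination by (relation "measure (\<lambda>(k, i, n). nat n)") auto

declare van_der_laan.simps [simp del]

text \<open>
  Rows and columns of matrices and vectors are counted from \<open>0\<close> in the library, so the mathematical
  entry \<open>(r, c)\<close> sits at position \<open>(r - 1, c - 1)\<close>. In the last row of \<open>V\<^sub>(\<^sub>k\<^sub>)\<close>, the entry in (library)
  column \<open>c\<close> is \<open>t\<^bsub>k - c\<^esub>\<close>, which for \<open>c = k - 1\<close> is \<open>t\<^sub>1 = 0\<close>.
\<close>

definition V_mat :: "nat \<Rightarrow> ratfun mat" where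
  "V_mat k = mat k k (\<lambda>(r, c).
     if r = k - 1 then tvar (k - c) else if c = r + 1 then 1 else 0)"

lemma tvar_nonzero: "j \<ge> 2 \<Longrightarrow> tvar j \<noteq> 0"
proof -
  assume "j \<ge> 2"
  have "indet j \<noteq> 0"
    unfolding indet_def by (metis lookup_single_eq lookup_zero zero_neq_one)
  with \<open>j \<ge> 2\<close> show ?thesis
    by (simp add: tvar_def Zero_fract_def eq_fract)
qed

lemma mat_inverse_V_mat:
  assumes "k \<ge> 2"
  obtains B where "mat_inverse (V_mat k) = Some B"
proof -
  have V: "V_mat k \<in> carrier_mat k k"
    by (simp add: V_mat_def)
  define B where "B = mat k k (\<lambda>(r, c).
    if r = 0 then (if c = k - 1 then 1 / tvar k else - tvar (k - 1 - c) / tvar k)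
    else if c = r - 1 then 1 else (0 :: ratfun))"
  have B: "B \<in> carrier_mat k k"
    by (simp add: B_def)
  have VB: "V_mat k * B = 1\<^sub>m k"
  proof (rule eq_matI)
    fix r c assume "r < dim_row (1\<^sub>m k :: ratfun mat)" "c < dim_col (1\<^sub>m k :: ratfun mat)"
    then have r: "r < k" and c: "c < k" by auto
    have e: "(V_mat k * B) $$ (r, c) = (\<Sum>m=0..<k. V_mat k $$ (r, m) * B $$ (m, c))"
      using r c V B by (simp add: scalar_prod_def)
    show "(V_mat k * B) $$ (r, c) = 1\<^sub>m k $$ (r, c)"
    proof (cases "r = k - 1")
      case False
      have "(\<Sum>m=0..<k. V_mat k $$ (r, m) * B $$ (m, c))
          = (\<Sum>m=0..<k. if m = r + 1 then B $$ (m, c) else 0)"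
        using False r by (intro sum.cong) (auto simp: V_mat_def)
      also have "\<dots> = B $$ (r + 1, c)"
        using False r by simp
      finally show ?thesis
        using e False r c by (auto simp: B_def)
    next
      case True
      have "(\<Sum>m=0..<k. V_mat k $$ (r, m) * B $$ (m, c))
          = tvar k * B $$ (0, c) + (\<Sum>m=1..<k. tvar (k - m) * B $$ (m, c))"
        using True r assms by (simp add: sum.atLeast_Suc_lessThan V_mat_def)
      also have "(\<Sum>m=1..<k. tvar (k - m) * B $$ (m, c))
          = (\<Sum>m=1..<k. if m = c + 1 then tvar (k - 1 - c) else 0)"
        using c by (intro sum.cong) (auto simp: B_def)
      also have "\<dots> = (if c = k - 1 then 0 else tvar (k - 1 - c))"
        using c by auto
      finally show ?thesis
        using e True r c tvar_nonzero[OF assms] by (auto simp: B_def)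
    qed
  qed (use V B in auto)
  have "V_mat k \<in> Units (ring_mat TYPE(ratfun) k ())"
    using V B VB mat_mult_left_right_inverse[OF V B VB]
    by (auto simp: Units_def ring_mat_def)
  with mat_inverse(1)[OF V, where b = "()"] that show ?thesis
    by (cases "mat_inverse (V_mat k)") auto
qed

definition V_mat_inv :: "nat \<Rightarrow> ratfun mat" where
  "V_mat_inv k = the (mat_inverse (V_mat k))"

definition w_vec :: "nat \<Rightarrow> ratfun vec" where
  "w_vec k = vec k (\<lambda>c. let j = c + 1 in
     if j \<le> k - 2 then - (of_nat j * tvar (k - j))
     else if j = k then of_nat k
     else 0)"

definition R_mat :: "nat \<Rightarrow> ratfun mat" where
  "R_mat k = mat_of_rows k
     (map (\<lambda>r. row (mat_of_row (w_vec k) * (V_mat_inv k ^\<^sub>m (k - r))) 0) [1..<Suc k])"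

function perrin :: "nat \<Rightarrow> nat \<Rightarrow> int \<Rightarrow> ratfun" where
  "perrin k i n =
     (if n \<le> 0 then R_mat k $$ (nat (int k + n) - 1, i - 1)
      else (\<Sum>j=2..k. tvar j * perrin k i (n - int j)))"
  by pat_completeness auto
termination by (relation "measure (\<lambda>(k, i, n). nat n)") auto

declare perrin.simps [simp del]

end

theory Submission
  imports Defs
begin

text \<open>
  Write \<open>V\<close> for the companion matrix and \<open>w\<close> for the row vector defining the generalized Perrin
  polynomials. The identity says that the \<open>n\<close>-th terms of the \<open>k\<close> Perrin sequences, read as a row
  vector, are \<open>w V\<^sup>n\<close>.

  Multiplying by \<open>V\<close> on the left slides a window of \<open>k\<close> consecutive terms of a sequence with the
  recurrence \<open>a\<^sub>n = \<Sum>\<^sub>j t\<^sub>j a\<^bsub>n-j\<^esub>\<close> one step forward. The initial windows of the \<open>k\<close> Van der Laan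
  sequences are the columns of the identity matrix, so the columns of \<open>V\<^sup>m\<close> are the windows ending in
  the \<open>m\<close>-th terms (\<open>V_mat_pow_entry\<close>). Hence, for every row vector \<open>x\<close>, the entries of \<open>x V\<^sup>m\<close>
  are combinations, with the coefficients \<open>x\<close>, of shifted Van der Laan sequences, and so satisfy the
  same recurrence in \<open>m\<close>, for \<open>m \<ge> k\<close>.

  The initial Perrin terms are the rows \<open>w V\<^bsup>-(k-r)\<^esup>\<close>. To avoid negative exponents, put
  \<open>x = w V\<^bsup>-(k-1)\<^esup>\<close>: these rows become \<open>x V\<^bsup>r-1\<^esup>\<close> with \<open>r - 1 \<ge> 0\<close>. The two sequences
  agree initially and satisfy the same recurrence, so the Perrin terms of index \<open>n > -k\<close> form the
  row \<open>x V\<^bsup>n+k-1\<^esup>\<close> (\<open>perrin_as_row_mult_power\<close>). For \<open>n \<ge> 0\<close> this is \<open>w V\<^sup>n\<close>, and expanding the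
  product along \<open>w\<close>, whose entry number \<open>k - 1\<close> is \<open>0\<close>, gives the formula.

  The detour through \<open>x\<close> is what makes the induction possible: for \<open>n < 0\<close> the right-hand side of
  the formula would involve Van der Laan terms of index below \<open>1 - k\<close>, whereas the combinations with
  coefficients \<open>x\<close> stay in the range where the Van der Laan sequences are meaningful.
\<close>

lemma pow_mat_add:
  fixes A :: "'a :: semiring_1 mat"
  assumes A: "A \<in> carrier_mat n n"
  shows "A ^\<^sub>m (a + b) = A ^\<^sub>m a * A ^\<^sub>m b"
proof (induction b)
  case 0
  then show ?case
    using A pow_carrier_mat[OF A, of a] by simp
next
  case (Suc b)
  then show ?case
    using A by (simp add: assoc_mult_mat[of _ n n _ n _ n] pow_carrier_mat)
qed

lemma pow_mat_Suc_left:
  fixes A :: "'a :: semiring_1 mat"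
  assumes "A \<in> carrier_mat n n"
  shows "A ^\<^sub>m Suc m = A * A ^\<^sub>m m"
  using pow_mat_add[OF assms, of 1 m] assms by simp

lemma V_mat_carrier: "V_mat k \<in> carrier_mat k k"
  by (simp add: V_mat_def)

lemma van_der_laan_init:
  assumes "n \<le> 0"
  shows "van_der_laan k i n = (if n = int i - int k then 1 else 0)"
  using assms by (subst van_der_laan.simps) simp

lemma van_der_laan_rec:
  assumes "n > 0"
  shows "van_der_laan k i n = (\<Sum>j=2..k. tvar j * van_der_laan k i (n - int j))"
  using assms by (subst van_der_laan.simps) simp

text \<open>
  Column \<open>c\<close> of \<open>V\<^sup>m\<close> lists the \<open>k\<close> consecutive terms with indices \<open>m + 1 - k, \<dots>, m\<close> of one Van der Laan
  sequence. In the product \<open>V V\<^sup>m\<close>, the superdiagonal of the left factor moves the rows up by one, and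
  its last row computes the next term by the recurrence.
\<close>

lemma V_mat_pow_entry:
  assumes "k \<ge> 2" "r < k" "c < k"
  shows "(V_mat k ^\<^sub>m m) $$ (r, c) = van_der_laan k (c + 1) (int m + int r + 1 - int k)"
  using \<open>r < k\<close>
proof (induction m arbitrary: r)
  case 0
  then show ?case
    using assms by (auto simp: van_der_laan_init V_mat_def)
next
  case (Suc m)
  have P: "V_mat k ^\<^sub>m m \<in> carrier_mat k k"
    by (simp add: V_mat_carrier pow_carrier_mat)
  have "V_mat k ^\<^sub>m Suc m = V_mat k * V_mat k ^\<^sub>m m"
    by (rule pow_mat_Suc_left[OF V_mat_carrier])
  then have e: "(V_mat k ^\<^sub>m Suc m) $$ (r, c)
      = (\<Sum>s<k. V_mat k $$ (r, s) * (V_mat k ^\<^sub>m m) $$ (s, c))"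
    using P V_mat_carrier[of k] Suc.prems \<open>c < k\<close>
    by (simp add: scalar_prod_def lessThan_atLeast0)
  show ?case
  proof (cases "r = k - 1")
    case False
    have "(\<Sum>s<k. V_mat k $$ (r, s) * (V_mat k ^\<^sub>m m) $$ (s, c))
        = (\<Sum>s<k. if s = r + 1 then (V_mat k ^\<^sub>m m) $$ (s, c) else 0)"
      using False Suc.prems by (intro sum.cong) (auto simp: V_mat_def)
    also have "\<dots> = (V_mat k ^\<^sub>m m) $$ (r + 1, c)"
      using False Suc.prems by simp
    also have "\<dots> = van_der_laan k (c + 1) (int m + int (r + 1) + 1 - int k)"
      using False Suc.prems by (intro Suc.IH) simp
    finally show ?thesis
      using e by (simp add: algebra_simps)
  next
    case True
    have "(\<Sum>s<k. V_mat k $$ (r, s) * (V_mat k ^\<^sub>m m) $$ (s, c))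
        = (\<Sum>s<k. tvar (k - s) * van_der_laan k (c + 1) (int m + int s + 1 - int k))"
      using True Suc.IH by (intro sum.cong) (auto simp: V_mat_def)
    also have "\<dots> = (\<Sum>j=1..k. tvar j * van_der_laan k (c + 1) (int m + 1 - int j))"
      by (rule sum.reindex_bij_witness[of _ "\<lambda>j. k - j" "\<lambda>s. k - s"])
        (auto simp: of_nat_diff algebra_simps)
    (* The last entry of the last row of V is t_1 = 0, so the sum may start at j = 2. *)
    also have "\<dots> = (\<Sum>j=2..k. tvar j * van_der_laan k (c + 1) (int m + 1 - int j))"
      using \<open>k \<ge> 2\<close> by (subst sum.atLeast_Suc_atMost) (simp_all add: tvar_def numeral_2_eq_2)
    also have "\<dots> = van_der_laan k (c + 1) (int m + 1)"
      by (rule van_der_laan_rec[symmetric]) simp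
    finally show ?thesis
      using e True Suc.prems by (simp add: of_nat_diff)
  qed
qed

lemma V_mat_inv:
  assumes "k \<ge> 2"
  shows V_mat_inv_carrier: "V_mat_inv k \<in> carrier_mat k k"
    and V_mat_inv_left: "V_mat_inv k * V_mat k = 1\<^sub>m k"
proof -
  obtain B where "mat_inverse (V_mat k) = Some B"
    using mat_inverse_V_mat[OF assms] .
  with mat_inverse(2)[OF V_mat_carrier]
  show "V_mat_inv k \<in> carrier_mat k k" "V_mat_inv k * V_mat k = 1\<^sub>m k"
    by (auto simp: V_mat_inv_def)
qed

lemma left_inverse_pow_cancel:
  fixes A B :: "'a :: semiring_1 mat"
  assumes A: "A \<in> carrier_mat n n" and B: "B \<in> carrier_mat n n" and BA: "B * A = 1\<^sub>m n"
  shows "B ^\<^sub>m (a + d) * A ^\<^sub>m d = B ^\<^sub>m a"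
proof (induction d)
  case 0
  then show ?case
    using A B pow_carrier_mat[OF B, of a] by simp
next
  case (Suc d)
  have "B ^\<^sub>m (a + Suc d) * A ^\<^sub>m Suc d = (B ^\<^sub>m (a + d) * B) * (A * A ^\<^sub>m d)"
    using pow_mat_Suc_left[OF A] by simp
  also have "\<dots> = B ^\<^sub>m (a + d) * ((B * A) * A ^\<^sub>m d)"
    using A B by (simp add: assoc_mult_mat[of _ n n _ n _ n] pow_carrier_mat)
  also have "\<dots> = B ^\<^sub>m a"
    using Suc A BA by (simp add: pow_carrier_mat)
  finally show ?case .
qed

lemma R_mat_entry:
  assumes "r < k" "c < k" "k \<ge> 2"
  shows "R_mat k $$ (r, c) = (mat_of_row (w_vec k) * V_mat_inv k ^\<^sub>m (k - 1 - r)) $$ (0, c)"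
  using assms V_mat_inv_carrier[of k] pow_carrier_mat[of "V_mat_inv k" k]
  by (simp add: R_mat_def mat_of_rows_def w_vec_def del: upt_Suc)

text \<open>
  The exponent \<open>m\<close> enters the right-hand side only as a shift of the index, with coefficients that
  do not depend on it; this is why these entries inherit the Van der Laan recurrence
  for \<open>m \<ge> k\<close>, where all the indices are positive.
\<close>

lemma row_mult_V_mat_pow_entry:
  assumes "k \<ge> 2" "x \<in> carrier_mat 1 k" "c < k"
  shows "(x * V_mat k ^\<^sub>m m) $$ (0, c)
    = (\<Sum>s<k. x $$ (0, s) * van_der_laan k (c + 1) (int m + int s + 1 - int k))"
proof -
  have "(x * V_mat k ^\<^sub>m m) $$ (0, c) = (\<Sum>s<k. x $$ (0, s) * (V_mat k ^\<^sub>m m) $$ (s, c))"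
    using carrier_matD[OF \<open>x \<in> carrier_mat 1 k\<close>] \<open>c < k\<close>
      carrier_matD[OF pow_carrier_mat[OF V_mat_carrier, of k m]]
    by (simp add: scalar_prod_def lessThan_atLeast0)
  then show ?thesis
    using assms by (simp add: V_mat_pow_entry)
qed

text \<open>
  A solution of the recurrence is determined by its terms with \<open>-k < n \<le> 0\<close>. There both sides agree
  because \<open>k - 1\<close> inverse factors followed by \<open>r\<close> direct ones leave \<open>V\<^bsup>-(k-1-r)\<^esup>\<close>, which produces
  row \<open>r\<close> (counted from \<open>0\<close>) of the matrix of initial values.
\<close>

lemma perrin_as_row_mult_power:
  fixes k c :: nat and n :: int
  assumes k: "k \<ge> 2" and c: "c < k" and n: "n > - int k"
  shows "perrin k (c + 1) n =
    (mat_of_row (w_vec k) * V_mat_inv k ^\<^sub>m (k - 1) * V_mat k ^\<^sub>m nat (n + int k - 1)) $$ (0, c)"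
proof -
  define w where "w = mat_of_row (w_vec k)"
  define x where "x = w * V_mat_inv k ^\<^sub>m (k - 1)"
  have w: "w \<in> carrier_mat 1 k"
    by (simp add: w_def w_vec_def)
  have B: "V_mat_inv k ^\<^sub>m p \<in> carrier_mat k k" for p
    using V_mat_inv_carrier[OF k] by (rule pow_carrier_mat)
  have V: "V_mat k ^\<^sub>m p \<in> carrier_mat k k" for p
    using V_mat_carrier by (rule pow_carrier_mat)
  have x: "x \<in> carrier_mat 1 k"
    using w B by (simp add: x_def)
  have "perrin k (c + 1) n = (\<Sum>s<k. x $$ (0, s) * van_der_laan k (c + 1) (n + int s))"
    using n
  proof (induction "nat (n + int k)" arbitrary: n rule: less_induct)
    case less
    show ?case
    proof (cases "n \<le> 0")
      case True
      define r where "r = nat (n + int k - 1)"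
      have r: "r < k" "n = int r + 1 - int k"
        using True less.prems by (auto simp: r_def)
      have "w * V_mat_inv k ^\<^sub>m (k - 1 - r) = x * V_mat k ^\<^sub>m r"
        using left_inverse_pow_cancel[OF V_mat_carrier V_mat_inv_carrier[OF k] V_mat_inv_left[OF k],
            of "k - 1 - r" r] r w
        by (simp add: x_def assoc_mult_mat[OF w B V])
      moreover have "perrin k (c + 1) n = R_mat k $$ (r, c)"
        using True r(2) by (subst perrin.simps) (simp add: nat_add_distrib)
      ultimately have "perrin k (c + 1) n = (x * V_mat k ^\<^sub>m r) $$ (0, c)"
        using R_mat_entry[OF r(1) c k] by (simp add: w_def)
      then show ?thesis
        unfolding row_mult_V_mat_pow_entry[OF k x c] r(2) by (simp add: algebra_simps)
    next
      case False
      have "perrin k (c + 1) n = (\<Sum>j=2..k. tvar j * perrin k (c + 1) (n - int j))"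
        using False by (subst perrin.simps) simp
      also have "\<dots> = (\<Sum>j=2..k. tvar j *
          (\<Sum>s<k. x $$ (0, s) * van_der_laan k (c + 1) (n - int j + int s)))"
        using False by (intro sum.cong refl arg_cong2[of _ _ _ _ "(*)"] less.hyps) auto
      also have "\<dots> = (\<Sum>s<k. x $$ (0, s) *
          (\<Sum>j=2..k. tvar j * van_der_laan k (c + 1) (n + int s - int j)))"
        unfolding sum_distrib_left by (subst sum.swap) (simp add: algebra_simps)
      also have "\<dots> = (\<Sum>s<k. x $$ (0, s) * van_der_laan k (c + 1) (n + int s))"
        (* n + s > 0 for all s, so each Van der Laan term is past its initial values. *)
        using False by (intro sum.cong refl) (simp add: van_der_laan_rec[of "n + _"])
      finally show ?thesis .
    qed
  qed
  then show ?thesis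
    unfolding w_def[symmetric] x_def[symmetric] row_mult_V_mat_pow_entry[OF k x c]
    using n by (simp add: algebra_simps)
qed

theorem theorem2p12:
  fixes k i :: nat and n :: int
  assumes "k \<ge> 3" and "1 \<le> i" and "i \<le> k" and "n \<ge> 0"
  shows "perrin k i n =
    of_nat k * van_der_laan k i n
      - (\<Sum>j=1..k - 2. of_nat j * tvar (k - j) * van_der_laan k i (n - int k + int j))"
proof -
  define w where "w = mat_of_row (w_vec k)"
  define c where "c = i - 1"
  have k: "k \<ge> 2" and c: "c < k" and i: "i = c + 1"
    using assms by (auto simp: c_def)
  have w: "w \<in> carrier_mat 1 k"
    by (simp add: w_def w_vec_def)
  have B: "V_mat_inv k ^\<^sub>m p \<in> carrier_mat k k" for p
    using V_mat_inv_carrier[OF k] by (rule pow_carrier_mat)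
  have V: "V_mat k ^\<^sub>m p \<in> carrier_mat k k" for p
    using V_mat_carrier by (rule pow_carrier_mat)
  have "nat (n + int k - 1) = (k - 1) + nat n"
    using assms by auto
  then have "V_mat k ^\<^sub>m nat (n + int k - 1) = V_mat k ^\<^sub>m (k - 1) * V_mat k ^\<^sub>m nat n"
    using pow_mat_add[OF V_mat_carrier] by simp
  then have "w * V_mat_inv k ^\<^sub>m (k - 1) * V_mat k ^\<^sub>m nat (n + int k - 1)
      = w * (V_mat_inv k ^\<^sub>m (0 + (k - 1)) * V_mat k ^\<^sub>m (k - 1)) * V_mat k ^\<^sub>m nat n"
    using assoc_mult_mat[OF mult_carrier_mat[OF w B] V V] assoc_mult_mat[OF w B V] by simp
  also have "\<dots> = w * V_mat k ^\<^sub>m nat n"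
    using w V_mat_inv_carrier[OF k]
    by (subst left_inverse_pow_cancel[OF V_mat_carrier V_mat_inv_carrier[OF k] V_mat_inv_left[OF k]])
      simp
  finally have "perrin k i n = (w * V_mat k ^\<^sub>m nat n) $$ (0, c)"
    using perrin_as_row_mult_power[OF k c, of n] assms by (simp add: w_def i)
  also have "\<dots> = (\<Sum>s<k. w $$ (0, s) * van_der_laan k i (n + int s + 1 - int k))"
    using assms by (simp add: row_mult_V_mat_pow_entry[OF k w c] i)
  also have "\<dots> = (\<Sum>j=1..k. w $$ (0, j - 1) * van_der_laan k i (n - int k + int j))"
    by (rule sum.reindex_bij_witness[of _ "\<lambda>j. j - 1" Suc]) (auto simp: algebra_simps)
  also have "{1..k} = insert k (insert (k - 1) {1..k - 2})"
    using \<open>k \<ge> 3\<close> by auto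
  also have "(\<Sum>j\<in>\<dots>. w $$ (0, j - 1) * van_der_laan k i (n - int k + int j))
      = w $$ (0, k - 1) * van_der_laan k i n + w $$ (0, k - 1 - 1) * van_der_laan k i (n - 1)
        + (\<Sum>j=1..k - 2. w $$ (0, j - 1) * van_der_laan k i (n - int k + int j))"
  proof -
    have "k \<notin> insert (k - 1) {1..k - 2}" "k - 1 \<notin> {1..k - 2}"
      using \<open>k \<ge> 3\<close> by auto
    then show ?thesis
      using \<open>k \<ge> 3\<close> by (simp add: of_nat_diff add.assoc del: One_nat_def)
  qed
  (* The entry of w belonging to j = k - 1 is 0, so the term with index n - 1 drops out. *)
  also have "\<dots> = of_nat k * van_der_laan k i n
      + (\<Sum>j=1..k - 2. - (of_nat j * tvar (k - j)) * van_der_laan k i (n - int k + int j))"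
  proof -
    have "w $$ (0, j - 1) = - (of_nat j * tvar (k - j))" if "j \<in> {1..k - 2}" for j
      using that by (auto simp: w_def w_vec_def mat_of_row_def Let_def simp del: of_nat_Suc)
    moreover have "w $$ (0, k - 1) = of_nat k" "w $$ (0, k - 1 - 1) = 0"
      using \<open>k \<ge> 3\<close> by (auto simp: w_def w_vec_def mat_of_row_def Let_def)
    ultimately show ?thesis
      by simp
  qed
  finally show ?thesis
    by (simp add: sum_negf)
qed

end
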